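(* Let $\sigma$ be the Tribonacci topological substitution on the prototiles $A,B,C$, let $\sigma^\infty(C)$ be the complex obtained from it by inflation, and let $C$ also denote the initial tile of $\sigma^\infty(C)$. Let $\omega_0(C,T)\in\mathbb Z^3$ be the position of a tile $T$ with respect to the initial tile $C$. Let $\mathbf M_s$ be the Tribonacci matrix, let $\Sigma_{\mathrm{step}}$ be the stepped surface of the Tribonacci dual substitution $\mathbf E$, and set $\theta(A)=3,\ \theta(B)=2,\ \theta(C)=1$ and $\mathbf u_A=\mathbf e_3-\mathbf e_1,\ \mathbf u_B=\mathbf e_2-\mathbf e_1,\ \mathbf u_C=\mathbf 0$. Then the map $\Psi$ defined, for every tile $T$ of $\sigma^\infty(C)$, by $$\Psi(T)=\big[\mathbf M_s^3\big(\omega_0(C,T)+\mathbf u_{\mathrm{type}(T)}\big),\ \theta(\mathrm{type}(T))\big]^*$$ is a bijection from the set of tiles of $\sigma^\infty(C)$ to the set of facets of $\Sigma_{\mathrm{step}}$.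
   Context: **The substitution $\sigma$.** The prototiles are three topological polygons (one-face CW-discs): hexagons $A$, $B$ with cyclically numbered vertices $A_0,\dots,A_5$ and $B_0,\dots,B_5$, and a decagon $C$ with cyclically numbered vertices $C_0,\dots,C_9$. For cyclically consecutive $i,j$, $X_{ij}$ is the edge of $X$ oriented from $X_i$ to $X_j$. $\sigma$ maps each prototile homeomorphically onto a patch (a CW-complex homeomorphic to a closed disc, each of whose faces has a type in $\{A,B,C\}$, i.e. is identified with that prototile): - $\sigma(A)$ is one face of type $B$, with $\sigma(A_i)=B_{i+2 \bmod 6}$. - $\sigma(B)$ is one face of type $C$, with $B_0,\dots,B_5\mapsto C_7,C_8,C_1,C_2,C_3,C_6$. - $\sigma(C)$ consists of one face of each type $A,B,C$, glued along $A_{45}=C_{54}$, $A_{43}=C_{56}$, $A_{23}=B_{05}$, $B_{45}=C_{76}$, with $C_0,\dots,C_9\mapsto A_5(=C_4),A_0,B_1,B_2,B_3,B_4(=C_7),C_8,C_1,C_2,C_3$. The image of an edge is the boundary arc between the images of its endpoints containing no other image of a vertex: $\sigma(B_{12})=C_{89}C_{90}C_{01}$, $\sigma(B_{45})=C_{34}C_{45}C_{56}$, $\sigma(C_{12})=A_{01}A_{12}B_{01}$, $\sigma(C_{67})=C_{89}C_{90}C_{01}$, and all other edges are mapped to a single edge. **Iteration and $\sigma^\infty(C)$.** $\sigma^{p+1}(X)$ is obtained by taking a copy of $\sigma(\mathrm{type}(f))$ for each face $f$ of $\sigma^p(X)$ and, for each edge $e$ shared by two faces $f,f'$, gluing edge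 to edge the two copies along the images under $\sigma$ of the edges of $\mathrm{type}(f)$, $\mathrm{type}(f')$ corresponding to $e$ (these images always have the same number of edges). Identify $C$ with the unique face of type $C$ in $\sigma(C)$; inductively $\sigma^k(C)$ is a subcomplex of $\sigma^{k+1}(C)$. Then $\sigma^\infty(C)=\bigcup_{k\ge0}\sigma^k(C)$, a CW-complex homeomorphic to $\mathbb R^2$, whose faces are called tiles. The initial tile is $\sigma^0(C)$. **Position map.** For two tiles $T,T'$ of $\sigma^\infty(C)$ sharing an edge, $\omega_0(T,T')\in\mathbb Z^3$ is given by the types of the glued edges (first edge in $T$, second in $T'$; only these gluings and their reverses occur), with $\omega_0(T',T)=-\omega_0(T,T')$: $[A_{23},B_{05}]\mapsto(0,-1,1)$; $[A_{05},B_{23}]\mapsto(0,1,-2)$; $[A_{45},C_{54}],[A_{43},C_{56}]\mapsto(-1,0,1)$; $[A_{12},C_{09}],[A_{01},C_{10}]\mapsto(1,-1,-1)$; $[B_{45},C_{76}]\mapsto(-1,1,0)$; $[B_{21},C_{12}]\mapsto(1,-2,1)$; $[B_{01},C_{98}]\mapsto(1,0,-2)$; $[B_{34},C_{43}]\mapsto(-1,-1,3)$; $[B_{05},C_{78}]\mapsto(0,1,-2)$; $[B_{32},C_{23}]\mapsto(0,-2,3)$; $[B_{43},B_{01}]\mapsto(-1,0,2)$; $[C_{12},C_{76}]\mapsto(-1,2,-1)$; $[C_{98},C_{56}],[C_{09},C_{45}],[C_{10},C_{34}]\mapsto(-1,0,2)$; $[C_{78},C_{32}]\mapsto(0,-2,3)$.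 For arbitrary tiles $T,T'$, $\omega_0(T,T')=\sum_{i=0}^{n-1}\omega_0(T_i,T_{i+1})$ for any sequence of tiles $T=T_0,\dots,T_n=T'$ with consecutive tiles distinct and sharing an edge (this does not depend on the sequence); $\omega_0(T,T)=\mathbf 0$. **Stepped surface.** $(\mathbf e_1,\mathbf e_2,\mathbf e_3)$ is the canonical basis of $\mathbb R^3$. For $\mathbf x\in\mathbb Z^3$, $i\in\{1,2,3\}$, the facet $[\mathbf x,i]^*$ is $\{\mathbf x+\lambda\mathbf e_j+\mu\mathbf e_k:\lambda,\mu\in[0,1]\}$ with $\{i,j,k\}=\{1,2,3\}$. $\mathbf M_s=\begin{pmatrix}1&1&1\\1&0&0\\0&1&0\end{pmatrix}$. The dual substitution $\mathbf E$ maps facets to sets of facets by $[\mathbf x,1]^*\mapsto\{[\mathbf M_s^{-1}\mathbf x,1]^*,[\mathbf M_s^{-1}\mathbf x,2]^*,[\mathbf M_s^{-1}\mathbf x,3]^*\}$, $[\mathbf x,2]^*\mapsto\{[\mathbf M_s^{-1}\mathbf x+\mathbf e_3,1]^*\}$, $[\mathbf x,3]^*\mapsto\{[\mathbf M_s^{-1}\mathbf x+\mathbf e_3,2]^*\}$, extended to sets of facets by unions. With $\mathcal U=\{[\mathbf 0,1]^*,[\mathbf 0,2]^*,[\mathbf 0,3]^*\}$, one has $\mathbf E^n(\mathcal U)\subset\mathbf E^{n+1}(\mathcal U)$ and $\Sigma_{\mathrm{step}}=\bigcup_n\mathbf E^n(\mathcal U)$. It is known (Arnoux–Ito and others) that the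 facets of $\Sigma_{\mathrm{step}}$ are exactly the $[\mathbf x,i]^*$ with $0\le\langle\mathbf x,\mathbf v_\beta\rangle<\langle\mathbf e_i,\mathbf v_\beta\rangle$, where $\mathbf v_\beta$ is a positive left eigenvector of $\mathbf M_s$ for its dominant eigenvalue $\beta>1$. *)

theory Defs
  imports "HOL-Analysis.Analysis"
begin

section \<open>The Tribonacci topological substitution\<close>

datatype prototile = A | B | C

fun num_vertices :: "prototile \<Rightarrow> nat" where
  "num_vertices A = 6"
| "num_vertices B = 6"
| "num_vertices C = 10"

text \<open>The triple (X, i, j), with i and j cyclically consecutive, is the edge of X
  oriented from the vertex i to the vertex j.  Vertices are triples without the last entry.\<close>

type_synonym vertex = "prototile \<times> nat"
type_synonym edge = "prototile \<times> nat \<times> nat"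

fun reverse_edge :: "edge \<Rightarrow> edge" where
  "reverse_edge (X, i, j) = (X, j, i)"

text \<open>The patch obtained from each prototile.  Since it contains at most one face of each type,
  its faces, edges and vertices are named by those of the prototiles.  A pair of edges (e, e')
  in \<open>patch_gluing\<close> is glued respecting orientation: start to start and end to end.\<close>

fun patch_faces :: "prototile \<Rightarrow> prototile set" where
  "patch_faces A = {B}"
| "patch_faces B = {C}"
| "patch_faces C = {A, B, C}"

fun patch_gluing :: "prototile \<Rightarrow> (edge \<times> edge) set" where
  "patch_gluing A = {}"
| "patch_gluing B = {}"
| "patch_gluing C =
    {((A,4,5), (C,5,4)), ((A,4,3), (C,5,6)), ((A,2,3), (B,0,5)), ((B,4,5), (C,7,6))}"

fun vertex_image :: "prototile \<Rightarrow> nat \<Rightarrow> vertex" where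
  "vertex_image A i = (B, (i + 2) mod 6)"
| "vertex_image B i = (C, [7, 8, 1, 2, 3, 6] ! i)"
| "vertex_image C i =
    [(A,5), (A,0), (B,1), (B,2), (B,3), (B,4), (C,8), (C,1), (C,2), (C,3)] ! i"

text \<open>Entry number i is the image, as an edge path, of the edge from i to i + 1
  (modulo the number of vertices).\<close>

fun edge_images :: "prototile \<Rightarrow> edge list list" where
  "edge_images A =
    [[(B,2,3)], [(B,3,4)], [(B,4,5)], [(B,5,0)], [(B,0,1)], [(B,1,2)]]"
| "edge_images B =
    [[(C,7,8)], [(C,8,9), (C,9,0), (C,0,1)], [(C,1,2)], [(C,2,3)],
     [(C,3,4), (C,4,5), (C,5,6)], [(C,6,7)]]"
| "edge_images C =
    [[(A,5,0)], [(A,0,1), (A,1,2), (B,0,1)], [(B,1,2)], [(B,2,3)], [(B,3,4)],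
     [(C,7,8)], [(C,8,9), (C,9,0), (C,0,1)], [(C,1,2)], [(C,2,3)], [(C,3,4)]]"

fun edge_image :: "edge \<Rightarrow> edge list" where
  "edge_image (X, i, j) =
    (if j = Suc i mod num_vertices X then edge_images X ! i
     else rev (map reverse_edge (edge_images X ! j)))"

text \<open>The following facts tie the edge images to the vertex images: in the glued patch, the image
  of an edge is a path in the boundary joining the images of its endpoints, and the images of the
  edges of a prototile together run exactly once through the boundary of the patch.\<close>

inductive same_vertex :: "prototile \<Rightarrow> vertex \<Rightarrow> vertex \<Rightarrow> bool" for X where
  start: "((Y, i, j), (Z, k, l)) \<in> patch_gluing X \<Longrightarrow> same_vertex X (Y, i) (Z, k)"
| end_: "((Y, i, j), (Z, k, l)) \<in> patch_gluing X \<Longrightarrow> same_vertex X (Y, j) (Z, l)"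
| refl: "same_vertex X v v"
| sym: "same_vertex X v w \<Longrightarrow> same_vertex X w v"
| trans: "same_vertex X u v \<Longrightarrow> same_vertex X v w \<Longrightarrow> same_vertex X u w"

fun edge_path :: "prototile \<Rightarrow> vertex \<Rightarrow> edge list \<Rightarrow> vertex \<Rightarrow> bool" where
  "edge_path X v [] w \<longleftrightarrow> same_vertex X v w"
| "edge_path X v ((Y, i, j) # es) w \<longleftrightarrow> same_vertex X v (Y, i) \<and> edge_path X (Y, j) es w"

lemma edge_images_path:
  assumes "i < num_vertices X"
  shows "edge_path X (vertex_image X i) (edge_image (X, i, Suc i mod num_vertices X))
    (vertex_image X (Suc i mod num_vertices X))"
proof -
  have [simp]: "same_vertex X v v" for X v
    by (rule same_vertex.refl)
  have [simp]: "same_vertex C (A, 2) (B, 0)"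
    by (rule same_vertex.start[of _ _ 3 _ _ 5]) simp
  have [simp]: "same_vertex C (B, 4) (C, 7)"
    by (rule same_vertex.start[of _ _ 5 _ _ 6]) simp
  have [simp]: "same_vertex C (C, 4) (A, 5)"
    by (rule same_vertex.sym, rule same_vertex.end_[of _ 4 _ _ 5]) simp
  have "i = 0 \<or> i = 1 \<or> i = 2 \<or> i = 3 \<or> i = 4 \<or> i = 5 \<or> i = 6 \<or> i = 7 \<or> i = 8 \<or> i = 9"
    using assms by (cases X) auto
  then show ?thesis
    using assms by (cases X) (elim disjE; simp add: nth_Cons' del: add_2_eq_Suc add_2_eq_Suc')+
qed

lemma edge_images_boundary:
  "distinct (concat (edge_images X))"
  "set (concat (edge_images X)) =
    {(Y, i, Suc i mod num_vertices Y) | Y i. Y \<in> patch_faces X \<and> i < num_vertices Y} -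
    (\<Union>(e, e') \<in> patch_gluing X. {e, reverse_edge e, e', reverse_edge e'})"
proof -
  have *: "{(Y, i, Suc i mod num_vertices Y) | Y i. Y \<in> F \<and> i < num_vertices Y} =
      (\<Union>Y\<in>F. (\<lambda>i. (Y, i, Suc i mod num_vertices Y)) ` set [0..<num_vertices Y])" for F
    by auto
  show "distinct (concat (edge_images X))"
    by (cases X) simp_all
  show "set (concat (edge_images X)) =
    {(Y, i, Suc i mod num_vertices Y) | Y i. Y \<in> patch_faces X \<and> i < num_vertices Y} -
    (\<Union>(e, e') \<in> patch_gluing X. {e, reverse_edge e, e', reverse_edge e'})"
    unfolding * by (cases X; hypsubst; code_simp)
qed


section \<open>The complex obtained by inflating the prototile C\<close>

text \<open>A face of the p-th iterate is named by the sequence of types of the face itself, of the face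
  of the iterate p - 1 whose image contains it, and so on up to the initial prototile C; this
  finite sequence is continued by the constant C.  As the prototile C is identified with the face of
  type C of its image, this convention turns the inclusion of each iterate into the next
  into an inclusion of sets.\<close>

type_synonym tile = "nat \<Rightarrow> prototile"

abbreviation tile_type :: "tile \<Rightarrow> prototile" where
  "tile_type T \<equiv> T 0"

definition child :: "prototile \<Rightarrow> tile \<Rightarrow> tile" where
  "child X T = case_nat X T"

definition initial_tile :: tile where
  "initial_tile = (\<lambda>_. C)"

fun faces :: "nat \<Rightarrow> tile set" where
  "faces 0 = {initial_tile}"
| "faces (Suc p) = {child X T | X T. T \<in> faces p \<and> X \<in> patch_faces (tile_type T)}"

text \<open>\<open>glued p T e T' e'\<close>: in the p-th iterate, the edge e of the face T is glued to the
  edge e' of the face T', respecting orientations.  The images of two glued edges always have the same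
  number of edges, so \<open>zip\<close> loses nothing.\<close>

inductive glued :: "nat \<Rightarrow> tile \<Rightarrow> edge \<Rightarrow> tile \<Rightarrow> edge \<Rightarrow> bool" where
  inner: "\<lbrakk>T \<in> faces p; (e, e') \<in> patch_gluing (tile_type T)\<rbrakk>
    \<Longrightarrow> glued (Suc p) (child (fst e) T) e (child (fst e') T) e'"
| outer: "\<lbrakk>glued p T e T' e'; (f, f') \<in> set (zip (edge_image e) (edge_image e'))\<rbrakk>
    \<Longrightarrow> glued (Suc p) (child (fst f) T) f (child (fst f') T') f'"
| swap: "glued p T e T' e' \<Longrightarrow> glued p T' e' T e"
| flip: "glued p T e T' e' \<Longrightarrow> glued p T (reverse_edge e) T' (reverse_edge e')"

lemma child_initial_tile: "child C initial_tile = initial_tile"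
  by (auto simp: child_def initial_tile_def split: nat.split)

lemma faces_mono: "faces p \<subseteq> faces (Suc p)"
proof (induction p)
  case 0
  have "child C initial_tile \<in> faces (Suc 0)"
    by (auto simp: initial_tile_def)
  then show ?case by (simp add: child_initial_tile)
next
  case (Suc p)
  then show ?case by fastforce
qed

lemma glued_mono: "glued p T e T' e' \<Longrightarrow> glued (Suc p) T e T' e'"
proof (induction rule: glued.induct)
  case (inner T p e e')
  then show ?case using faces_mono glued.inner by blast
qed (auto intro: glued.intros)

definition tiles :: "tile set" where
  "tiles = (\<Union>p. faces p)"

definition glued_tiles :: "tile \<Rightarrow> edge \<Rightarrow> tile \<Rightarrow> edge \<Rightarrow> bool" where
  "glued_tiles T e T' e' \<longleftrightarrow> (\<exists>p. glued p T e T' e')"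

definition adjacent :: "tile \<Rightarrow> tile \<Rightarrow> bool" where
  "adjacent T T' \<longleftrightarrow> T \<noteq> T' \<and> (\<exists>e e'. glued_tiles T e T' e')"


section \<open>The position map\<close>

definition gluing_table :: "(edge \<times> edge \<times> (int ^ 3)) set" where
  "gluing_table =
    {((A,2,3), (B,0,5), vector [0, -1, 1]),
     ((A,0,5), (B,2,3), vector [0, 1, -2]),
     ((A,4,5), (C,5,4), vector [-1, 0, 1]),
     ((A,4,3), (C,5,6), vector [-1, 0, 1]),
     ((A,1,2), (C,0,9), vector [1, -1, -1]),
     ((A,0,1), (C,1,0), vector [1, -1, -1]),
     ((B,4,5), (C,7,6), vector [-1, 1, 0]),
     ((B,2,1), (C,1,2), vector [1, -2, 1]),
     ((B,0,1), (C,9,8), vector [1, 0, -2]),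
     ((B,3,4), (C,4,3), vector [-1, -1, 3]),
     ((B,0,5), (C,7,8), vector [0, 1, -2]),
     ((B,3,2), (C,2,3), vector [0, -2, 3]),
     ((B,4,3), (B,0,1), vector [-1, 0, 2]),
     ((C,1,2), (C,7,6), vector [-1, 2, -1]),
     ((C,9,8), (C,5,6), vector [-1, 0, 2]),
     ((C,0,9), (C,4,5), vector [-1, 0, 2]),
     ((C,1,0), (C,3,4), vector [-1, 0, 2]),
     ((C,7,8), (C,3,2), vector [0, -2, 3])}"

inductive gluing_vector :: "edge \<Rightarrow> edge \<Rightarrow> int ^ 3 \<Rightarrow> bool" where
  table: "(e, e', v) \<in> gluing_table \<Longrightarrow> gluing_vector e e' v"
| flip: "gluing_vector e e' v \<Longrightarrow> gluing_vector (reverse_edge e) (reverse_edge e') v"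
| swap: "gluing_vector e e' v \<Longrightarrow> gluing_vector e' e (- v)"

definition step_position :: "tile \<Rightarrow> tile \<Rightarrow> int ^ 3" where
  "step_position T T' = (THE v. \<exists>e e'. glued_tiles T e T' e' \<and> gluing_vector e e' v)"

definition tile_walk :: "nat \<Rightarrow> (nat \<Rightarrow> tile) \<Rightarrow> bool" where
  "tile_walk n S \<longleftrightarrow> (\<forall>i\<le>n. S i \<in> tiles) \<and> (\<forall>i<n. adjacent (S i) (S (Suc i)))"

definition omega0 :: "tile \<Rightarrow> tile \<Rightarrow> int ^ 3" where
  "omega0 T T' = (THE v. \<exists>n S. tile_walk n S \<and> S 0 = T \<and> S n = T' \<and>
    v = (\<Sum>i<n. step_position (S i) (S (Suc i))))"


section \<open>The stepped surface\<close>

definition Ms :: "int ^ 3 ^ 3" where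
  "Ms = vector [vector [1, 1, 1], vector [1, 0, 0], vector [0, 1, 0]]"

definition facet :: "int ^ 3 \<Rightarrow> 3 \<Rightarrow> (real ^ 3) set" where
  "facet x i = {(\<chi> n. of_int (x $ n)) + a *\<^sub>R axis j 1 + b *\<^sub>R axis k 1 | a b j k.
    {i, j, k} = {1, 2, 3} \<and> a \<in> {0..1} \<and> b \<in> {0..1}}"

lemma UNIV_3_distinct: "{i, j, k} = {1, 2, 3 :: 3} \<longleftrightarrow> i \<noteq> j \<and> i \<noteq> k \<and> j \<noteq> k"
  using exhaust_3[of i] exhaust_3[of j] exhaust_3[of k]
  by (elim disjE) (auto simp: set_eq_iff forall_3)

lemma mem_facet_iff:
  "z \<in> facet x i \<longleftrightarrow>
    (\<forall>n. of_int (x $ n) \<le> z $ n \<and> z $ n \<le> of_int (x $ n) + (if n = i then 0 else 1))"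
proof
  assume "z \<in> facet x i"
  then show "\<forall>n. of_int (x $ n) \<le> z $ n \<and> z $ n \<le> of_int (x $ n) + (if n = i then 0 else 1)"
    by (auto simp: facet_def UNIV_3_distinct axis_def)
next
  assume *: "\<forall>n. of_int (x $ n) \<le> z $ n \<and> z $ n \<le> of_int (x $ n) + (if n = i then 0 else 1)"
  have "\<exists>j k :: 3. {i, j, k} = {1, 2, 3}"
    using exhaust_3[of i] by (elim disjE) blast+
  then obtain j k where ijk: "{i, j, k} = {1, 2, 3}" by blast
  then have jk: "i \<noteq> j" "i \<noteq> k" "j \<noteq> k"
    by (simp_all add: UNIV_3_distinct)
  have cases: "n = i \<or> n = j \<or> n = k" for n
    using exhaust_3[of n] ijk by blast
  have "z $ i = of_int (x $ i)"
    using *[rule_format, of i] by simp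
  then have "z = (\<chi> n. of_int (x $ n)) + (z $ j - of_int (x $ j)) *\<^sub>R axis j 1
      + (z $ k - of_int (x $ k)) *\<^sub>R axis k 1"
    unfolding vec_eq_iff using jk cases by (fastforce simp: axis_def)
  moreover have "z $ j - of_int (x $ j) \<in> {0..1}" "z $ k - of_int (x $ k) \<in> {0..1}"
    using jk *[rule_format, of j] *[rule_format, of k] by auto
  ultimately show "z \<in> facet x i"
    using jk unfolding facet_def UNIV_3_distinct by blast
qed

lemma facet_eq_iff: "facet x i = facet y j \<longleftrightarrow> x = y \<and> i = j"
proof
  assume eq: "facet x i = facet y j"
  have "x $ n \<le> y $ n" if "facet x i = facet y j" for x y i j n
  proof -
    have "(\<chi> n. real_of_int (y $ n)) \<in> facet x i"
      unfolding that by (simp add: mem_facet_iff)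
    then show ?thesis
      unfolding mem_facet_iff by simp
  qed
  then have xy: "x = y"
    using eq by (metis vec_eq_iff order.antisym)
  have "i = j"
  proof (rule ccontr)
    assume "i \<noteq> j"
    then have "(\<chi> n. real_of_int (x $ n)) + axis j 1 \<in> facet x i"
      by (auto simp: mem_facet_iff axis_def)
    then have "(\<chi> n. real_of_int (y $ n)) + axis j 1 \<in> facet y j"
      using eq xy by simp
    then show False
      by (auto simp: mem_facet_iff axis_def dest: spec[of _ j])
  qed
  with xy show "x = y \<and> i = j" ..
qed simp

text \<open>By \<open>facet_eq_iff\<close>, a facet determines its base point and type, so that \<open>dual_subst\<close> applies
  \<open>dual_subst_facet\<close> once to each facet.\<close>

definition dual_subst_facet :: "int ^ 3 \<Rightarrow> 3 \<Rightarrow> (real ^ 3) set set" where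
  "dual_subst_facet x i =
    (let y = matrix_inv Ms *v x in
     if i = 1 then {facet y 1, facet y 2, facet y 3}
     else if i = 2 then {facet (y + axis 3 1) 1}
     else {facet (y + axis 3 1) 2})"

definition dual_subst :: "(real ^ 3) set set \<Rightarrow> (real ^ 3) set set" where
  "dual_subst F = \<Union> {dual_subst_facet x i | x i. facet x i \<in> F}"

definition Sigma_step :: "(real ^ 3) set set" where
  "Sigma_step = (\<Union>n. (dual_subst ^^ n) {facet 0 1, facet 0 2, facet 0 3})"

fun theta :: "prototile \<Rightarrow> 3" where
  "theta A = 3"
| "theta B = 2"
| "theta C = 1"

fun u_vec :: "prototile \<Rightarrow> int ^ 3" where
  "u_vec A = axis 3 1 - axis 1 1"
| "u_vec B = axis 2 1 - axis 1 1"
| "u_vec C = 0"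

end

theory Submission
  imports Defs
begin

text \<open>Write M for the Tribonacci matrix and a facet as a pair of a base point x and an index i.  The
  dual substitution sends it to facets with base point \<open>M\<inverse> x\<close> if i = 1 and \<open>M\<inverse> x + e\<^sub>3\<close> otherwise.
  If \<open>theta\<close> is used to read indices as types, then the indices of these facets are the types of the
  faces that \<open>\<sigma>\<close> puts in place of a face of type i.  So the same recursion attaches to each tile T a base point, and hence a facet \<open>tile_facet T\<close>, such
  that applying E to the facets of one iterate gives those of the next
  (\<open>dual_subst_faces\<close>).  The initial tile gets the facet \<open>[0, 1]\<close>, whose image is the seed
  \<open>U\<close>; therefore the facets of all tiles are exactly those of the stepped surface
  (\<open>Sigma_step_eq\<close>).

  Distinct tiles get distinct facets, although E in general sends several facets to the same one.  Let
  b be the dominant eigenvalue and measure the height of a point by its product with a positive left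
  eigenvector.  Then the height of a base point lies between 0 and the entry of the
  eigenvector at the index of the facet (\<open>height_bounds\<close>), and under this restriction the height of
  a facet shows whether its parent has type C (\<open>parent_type_C_iff\<close>).  Together with the type
  of the facet this determines the parent, and injectivity follows by induction.

  It remains to see that the map of the theorem is this one.  Solving the formula that defines it for
  the position vector gives a function \<open>position\<close> of the tile alone.  One finite check on
  the gluing table (\<open>gluing_vector_images\<close>) shows that refining two glued tiles changes their
  difference of positions exactly as the table predicts for the new pairs of glued edges; so
  \<open>position\<close> is a potential for the steps of a walk (\<open>glued_position\<close>).  Since the
  complex is connected (\<open>faces_connected\<close>), the vector \<open>omega0 initial_tile T\<close> is the
  position of T.\<close>


section \<open>The inverse of the Tribonacci matrix\<close>

lemma vec3_eq_iff: "x = y \<longleftrightarrow> x $ 1 = y $ 1 \<and> x $ 2 = y $ 2 \<and> x $ (3 :: 3) = y $ 3"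
  by (auto simp: vec_eq_iff forall_3)

lemma Ms_mult_nth [simp]:
  "(Ms *v x) $ 1 = x $ 1 + x $ 2 + x $ 3" "(Ms *v x) $ 2 = x $ 1" "(Ms *v x) $ 3 = x $ 2"
  by (simp_all add: Ms_def matrix_vector_mult_def sum_3)

lemma matrix_inv_Ms_nth [simp]:
  "(matrix_inv Ms *v x) $ 1 = x $ 2" "(matrix_inv Ms *v x) $ 2 = x $ 3"
  "(matrix_inv Ms *v x) $ 3 = x $ 1 - x $ 2 - x $ 3"
proof -
  let ?N = "vector [vector [0, 1, 0], vector [0, 0, 1], vector [1, -1, -1]] :: int ^ 3 ^ 3"
  have "Ms ** ?N = mat 1" "?N ** Ms = mat 1"
    by (simp_all add: Ms_def matrix_matrix_mult_def mat_def sum_3 vec3_eq_iff)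
  then have "\<exists>N. Ms ** N = mat 1 \<and> N ** Ms = mat 1"
    by blast
  then have "Ms ** matrix_inv Ms = mat 1"
    unfolding matrix_inv_def by (rule someI2_ex) blast
  then have "Ms *v (matrix_inv Ms *v x) = x"
    by (simp add: matrix_vector_mul_assoc)
  then have "\<forall>n. (Ms *v (matrix_inv Ms *v x)) $ n = x $ n"
    by simp
  \<comment> \<open>Reading these three equations with the rules for the entries of \<open>Ms *v _\<close> solves for the entries of the preimage.\<close>
  then show "(matrix_inv Ms *v x) $ 1 = x $ 2" "(matrix_inv Ms *v x) $ 2 = x $ 3"
    "(matrix_inv Ms *v x) $ 3 = x $ 1 - x $ 2 - x $ 3"
    by (auto simp: forall_3)
qed

lemma Ms_matrix_inv [simp]: "Ms *v (matrix_inv Ms *v x) = x"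
  by (simp add: vec3_eq_iff)

lemma axis_3_nth [simp]:
  "(axis 1 a :: int ^ 3) $ 1 = a" "(axis 1 a :: int ^ 3) $ 2 = 0" "(axis 1 a :: int ^ 3) $ 3 = 0"
  "(axis 2 a :: int ^ 3) $ 1 = 0" "(axis 2 a :: int ^ 3) $ 2 = a" "(axis 2 a :: int ^ 3) $ 3 = 0"
  "(axis 3 a :: int ^ 3) $ 1 = 0" "(axis 3 a :: int ^ 3) $ 2 = 0" "(axis 3 a :: int ^ 3) $ 3 = a"
  by (simp_all add: axis_def)


section \<open>Tiles and their base points\<close>

lemma child_simps [simp]: "child X T 0 = X" "child X T (Suc n) = T n"
  by (simp_all add: child_def)

lemma child_inject [simp]: "child X T = child Y S \<longleftrightarrow> X = Y \<and> T = S"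
proof
  assume *: "child X T = child Y S"
  have "X = Y" using fun_cong[OF *, of 0] by simp
  moreover have "T n = S n" for n using fun_cong[OF *, of "Suc n"] by simp
  ultimately show "X = Y \<and> T = S" by auto
qed simp

lemma faces_mono_le: "p \<le> q \<Longrightarrow> faces p \<subseteq> faces q"
  using faces_mono by (rule lift_Suc_mono_le)

lemma initial_tile_in_faces: "initial_tile \<in> faces p"
  using faces_mono_le[of 0 p] by auto

lemma faces_eventually_C: "T \<in> faces p \<Longrightarrow> k \<ge> p \<Longrightarrow> T k = C"
proof (induction p arbitrary: T k)
  case 0
  then show ?case by (simp add: initial_tile_def)
next
  case (Suc p)
  then obtain X S where "T = child X S" "S \<in> faces p" by auto
  with Suc show ?case by (cases k) auto
qed

lemma finite_non_C: "T \<in> faces p \<Longrightarrow> finite {k. T k \<noteq> C}"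
  by (rule finite_subset[of _ "{..<p}"]) (auto intro: leI dest: faces_eventually_C)

text \<open>The solution of the recursion \<open>base_point_child\<close> that vanishes at the initial tile, written
  out as a series: every ancestor of type other than C contributes \<open>e\<^sub>3\<close>, multiplied by the
  inverse matrix once for each generation after that of its child.  Only finitely many entries of a tile differ from C.  In
  this form the value does not depend on the iterate in which the tile is regarded.\<close>

definition base_point :: "tile \<Rightarrow> int ^ 3" where
  "base_point T = (\<Sum>k | T (Suc k) \<noteq> C. ((*v) (matrix_inv Ms) ^^ k) (axis 3 1))"

definition tile_facet :: "tile \<Rightarrow> (real ^ 3) set" where
  "tile_facet T = facet (base_point T) (theta (tile_type T))"

lemma base_point_initial: "base_point initial_tile = 0"
  by (simp add: base_point_def initial_tile_def)

lemma base_point_child: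
  assumes "T \<in> faces p"
  shows "base_point (child X T) =
    matrix_inv Ms *v base_point T + (if tile_type T = C then 0 else axis 3 1)"
proof -
  let ?N = "(*v) (matrix_inv Ms) :: int ^ 3 \<Rightarrow> int ^ 3"
  let ?K = "{k. T (Suc k) \<noteq> C}"
  have "finite (Suc -` {k. T k \<noteq> C})"
    using finite_non_C[OF assms] by (intro finite_vimageI) auto
  then have fin: "finite ?K"
    by (simp add: vimage_def)
  have "{k. child X T (Suc k) \<noteq> C} = (if tile_type T = C then {} else {0}) \<union> Suc ` ?K"
    (is "?L = ?R")
  proof (rule set_eqI)
    fix k show "k \<in> ?L \<longleftrightarrow> k \<in> ?R" by (cases k) auto
  qed
  then have "base_point (child X T) = (\<Sum>k\<in>?R. (?N ^^ k) (axis 3 1))"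
    by (simp add: base_point_def)
  also have "\<dots> = (if tile_type T = C then 0 else axis 3 1)
      + (\<Sum>k\<in>Suc ` ?K. (?N ^^ k) (axis 3 1))"
    using fin by (subst sum.union_disjoint) auto
  also have "(\<Sum>k\<in>Suc ` ?K. (?N ^^ k) (axis 3 1)) = (\<Sum>k\<in>?K. ?N ((?N ^^ k) (axis 3 1)))"
    by (simp add: sum.reindex)
  also have "\<dots> = ?N (base_point T)"
    unfolding base_point_def
    by (rule sum_comp_morphism[of ?N, unfolded comp_def])
      (simp_all add: vec3_eq_iff)
  finally show ?thesis by simp
qed


section \<open>The stepped surface as the image of the tiles\<close>

text \<open>Via \<open>theta\<close>, the three cases of the dual substitution match the faces of the patches of C, B and
  A: a facet of index 1 gives one facet of each index, as \<open>\<sigma>(C)\<close> has one face of each type; index 2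
  gives index 1, as \<open>\<sigma>(B)\<close> is a face of type C; and index 3 gives index 2, as \<open>\<sigma>(A)\<close> is a face of type
  B.\<close>

lemma dual_subst_tile_facet:
  assumes "T \<in> faces p"
  shows "dual_subst_facet (base_point T) (theta (tile_type T)) =
    (\<lambda>X. tile_facet (child X T)) ` patch_faces (tile_type T)"
  using base_point_child[OF assms]
  by (cases "tile_type T") (auto simp: dual_subst_facet_def tile_facet_def Let_def)

lemma dual_subst_faces: "dual_subst (tile_facet ` faces p) = tile_facet ` faces (Suc p)"
proof -
  have "dual_subst (tile_facet ` faces p) =
      (\<Union>T\<in>faces p. dual_subst_facet (base_point T) (theta (tile_type T)))"
    by (fastforce simp: dual_subst_def tile_facet_def facet_eq_iff)
  also have "\<dots> = (\<Union>T\<in>faces p. (\<lambda>X. tile_facet (child X T)) ` patch_faces (tile_type T))"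
    by (simp add: dual_subst_tile_facet)
  also have "\<dots> = tile_facet ` faces (Suc p)"
    by auto
  finally show ?thesis .
qed

lemma Sigma_step_eq: "Sigma_step = tile_facet ` tiles"
proof -
  \<comment> \<open>The seed consists of the facets of the first iterate, so that the exponents differ by one.\<close>
  have start: "{facet 0 1, facet 0 2, facet 0 3} = tile_facet ` faces 1"
  proof -
    have "tile_facet (child X initial_tile) = facet 0 (theta X)" for X
      using base_point_child[OF initial_tile_in_faces, of X]
      by (simp add: tile_facet_def base_point_initial) (simp add: initial_tile_def)
    moreover have "faces 1 = (\<lambda>X. child X initial_tile) ` {A, B, C}"
      by (auto simp: initial_tile_def)
    ultimately show ?thesis by (auto simp: image_image)
  qed
  have "(dual_subst ^^ n) {facet 0 1, facet 0 2, facet 0 3} = tile_facet ` faces (Suc n)" for n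
  proof (induction n)
    case 0
    then show ?case using start by simp
  next
    case (Suc n)
    then show ?case by (simp only: funpow.simps comp_apply dual_subst_faces)
  qed
  then have "Sigma_step = tile_facet ` (\<Union>n. faces (Suc n))"
    unfolding Sigma_step_def by blast
  also have "(\<Union>n. faces (Suc n)) = tiles"
    unfolding tiles_def using faces_mono by blast
  finally show ?thesis .
qed

section \<open>Distinct tiles have distinct facets\<close>

text \<open>If \<open>b\<^sup>3 = b\<^sup>2 + b + 1\<close>, then \<open>(b, b\<^sup>2 - b, 1)\<close> is a left eigenvector of \<open>Ms\<close> for the
  eigenvalue b.  The height is the product with this vector, and \<open>thickness b X\<close> is its entry at
  \<open>theta X\<close>.\<close>

definition height :: "real \<Rightarrow> int ^ 3 \<Rightarrow> real" where
  "height b x = b * x $ 1 + (b\<^sup>2 - b) * x $ 2 + x $ 3"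

fun thickness :: "real \<Rightarrow> prototile \<Rightarrow> real" where
  "thickness b A = 1"
| "thickness b B = b\<^sup>2 - b"
| "thickness b C = b"

lemma tribonacci_root: "\<exists>b :: real. b > 1 \<and> b ^ 3 = b\<^sup>2 + b + 1"
proof -
  have "\<exists>b \<ge> 1. b \<le> 2 \<and> b ^ 3 - b\<^sup>2 - b - 1 = (0 :: real)"
    by (rule IVT') (auto intro!: continuous_intros)
  then obtain b :: real where b: "b \<ge> 1" "b ^ 3 - b\<^sup>2 - b - 1 = 0"
    by blast
  then have "b \<noteq> 1" by auto
  with b show ?thesis by (intro exI[of _ b]) auto
qed

context
  fixes b :: real
  assumes b: "b > 1" "b ^ 3 = b\<^sup>2 + b + 1"
begin

lemma thickness_ge_1: "thickness b X \<ge> 1"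
proof -
  have "b * (b\<^sup>2 - b) = b + 1"
    using b(2) by (simp add: algebra_simps power2_eq_square power3_eq_cube)
  then have "b * (b\<^sup>2 - b) > b * 1" by simp
  then have "b\<^sup>2 - b > 1" using b(1) by (simp only: mult_less_cancel_left_pos)
  then show ?thesis using b(1) by (cases X) auto
qed

text \<open>The eigenvector equation: the inverse matrix divides heights by b; and \<open>e\<^sub>3\<close> has height 1.\<close>

lemma height_child:
  assumes "T \<in> faces p"
  shows "b * height b (base_point (child X T)) =
    height b (base_point T) + (if tile_type T = C then 0 else b)"
proof -
  have "b * (b * y + (b\<^sup>2 - b) * z + (x - y - z)) = b * x + (b\<^sup>2 - b) * y + z" for x y z
    using b(2) by algebra
  then have "b * height b (matrix_inv Ms *v x) = height b x" for x
    by (simp add: height_def)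
  moreover have "height b (x + axis 3 1) = height b x + 1" for x
    by (simp add: height_def)
  ultimately show ?thesis
    by (simp add: base_point_child[OF assms] distrib_left)
qed

text \<open>This is the easy half of the arithmetic description of the stepped surface.  Every child of a
  facet inherits the bounds: below a tile of type C heights are divided by b and become less than 1,
  the smallest thickness, while below the other types the new bounds \<open>(b\<^sup>2 - b) / b + 1\<close> and
  \<open>1 / b + 1\<close> are exactly the thicknesses of C and B.\<close>

lemma height_bounds:
  "T \<in> faces p \<Longrightarrow>
    0 \<le> height b (base_point T) \<and> height b (base_point T) < thickness b (tile_type T)"
proof (induction p arbitrary: T)
  case 0
  then have "base_point T = 0" "tile_type T = C"
    by (simp_all add: base_point_initial) (simp add: initial_tile_def)
  then show ?case
    using b by (simp add: height_def)
next
  case (Suc p)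
  then obtain X S where T: "T = child X S" "S \<in> faces p" "X \<in> patch_faces (tile_type S)"
    by auto
  let ?h = "height b (base_point S)" and ?h' = "height b (base_point T)"
  have h: "0 \<le> ?h" "?h < thickness b (tile_type S)"
    using Suc.IH[OF T(2)] by auto
  have h': "b * ?h' = ?h + (if tile_type S = C then 0 else b)"
    using height_child[OF T(2)] T(1) by simp
  have "0 \<le> b * ?h'"
    using h h' b(1) by auto
  then have pos: "0 \<le> ?h'"
    using b(1) by (simp add: zero_le_mult_iff)
  have "b * ?h' < b * thickness b X"
  proof (cases "tile_type S")
    case A
    then show ?thesis
      using h h' b T(3) by (simp add: algebra_simps power2_eq_square power3_eq_cube)
  next
    case B
    then show ?thesis
      using h h' b T(3) by (simp add: algebra_simps power2_eq_square power3_eq_cube)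
  next
    case C
    then have "b * ?h' < b * 1" using h h' by simp
    also have "\<dots> \<le> b * thickness b X" using thickness_ge_1 b(1) by (intro mult_left_mono) auto
    finally show ?thesis .
  qed
  then have "?h' < thickness b X"
    using b(1) by simp
  with pos T(1) show ?case by simp
qed

text \<open>The children of a tile of type C lie in the layer of heights below 1; all other tiles have been
  lifted by \<open>e\<^sub>3\<close> and lie above it.\<close>

lemma parent_type_C_iff:
  assumes "T \<in> faces p"
  shows "tile_type T = C \<longleftrightarrow> height b (base_point (child X T)) < 1"
proof -
  let ?h' = "height b (base_point (child X T))"
  have "tile_type T = C \<longleftrightarrow> b * ?h' < b * 1"
    using height_child[OF assms, of X] height_bounds[OF assms] by auto
  then show ?thesis using b(1) by (simp only: mult_less_cancel_left_pos)
qed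

end

lemma theta_inject: "theta X = theta Y \<longleftrightarrow> X = Y"
  by (cases X; cases Y) auto

text \<open>A type occurs in \<open>\<sigma>(C)\<close> and in at most one other patch.\<close>

lemma patch_faces_parent:
  assumes "X \<in> patch_faces Y" "X \<in> patch_faces Z" "Y = C \<longleftrightarrow> Z = C"
  shows "Y = Z"
  using assms by (cases X; cases Y; cases Z) auto

lemma tile_facet_inj_faces:
  "T \<in> faces p \<Longrightarrow> T' \<in> faces p \<Longrightarrow> tile_facet T = tile_facet T' \<Longrightarrow> T = T'"
proof (induction p arbitrary: T T')
  case 0
  then show ?case by simp
next
  case (Suc p)
  obtain b :: real where b: "b > 1" "b ^ 3 = b\<^sup>2 + b + 1"
    using tribonacci_root by blast
  obtain X S where T: "T = child X S" "S \<in> faces p" "X \<in> patch_faces (tile_type S)"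
    using Suc.prems(1) by auto
  obtain X' S' where T': "T' = child X' S'" "S' \<in> faces p" "X' \<in> patch_faces (tile_type S')"
    using Suc.prems(2) by auto
  have X: "X' = X" and base: "base_point (child X S) = base_point (child X S')"
    using Suc.prems(3) T(1) T'(1) by (auto simp: tile_facet_def facet_eq_iff theta_inject)
  have "tile_type S = C \<longleftrightarrow> tile_type S' = C"
    using parent_type_C_iff[OF b] T(2) T'(2) base by metis
  then have type: "tile_type S = tile_type S'"
    using patch_faces_parent T(3) T'(3) X by blast
  then have "matrix_inv Ms *v base_point S = matrix_inv Ms *v base_point S'"
    using base base_point_child T(2) T'(2) by simp
  then have "base_point S = base_point S'"
    by (metis Ms_matrix_inv)
  with type have "S = S'"
    by (intro Suc.IH T(2) T'(2)) (simp add: tile_facet_def)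
  then show ?case using T(1) T'(1) X by simp
qed

lemma inj_on_tile_facet: "inj_on tile_facet tiles"
proof (rule inj_onI)
  fix T T' assume "T \<in> tiles" "T' \<in> tiles" and eq: "tile_facet T = tile_facet T'"
  then obtain p q where "T \<in> faces p" "T' \<in> faces q"
    unfolding tiles_def by blast
  then have "T \<in> faces (max p q)" "T' \<in> faces (max p q)"
    using faces_mono_le[of p "max p q"] faces_mono_le[of q "max p q"] by auto
  then show "T = T'" using eq by (rule tile_facet_inj_faces)
qed


section \<open>Glued edges and the gluing table\<close>

lemma reverse_edge_reverse_edge [simp]: "reverse_edge (reverse_edge e) = e"
  by (cases e) simp

lemma fst_reverse_edge [simp]: "fst (reverse_edge e) = fst e"
  by (cases e) simp

fun is_edge :: "edge \<Rightarrow> bool" where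
  "is_edge (X, i, j) \<longleftrightarrow> i < num_vertices X \<and> j < num_vertices X \<and>
    (j = Suc i mod num_vertices X \<or> i = Suc j mod num_vertices X)"

lemma is_edge_reverse [simp]: "is_edge (reverse_edge e) = is_edge e"
  by (cases e) auto

lemma edge_image_reverse:
  assumes "is_edge e"
  shows "edge_image (reverse_edge e) = rev (map reverse_edge (edge_image e))"
proof -
  obtain X i j where e: "e = (X, i, j)" by (cases e)
  have not_both: "\<not> (j = Suc i mod num_vertices X \<and> i = Suc j mod num_vertices X)"
    using assms e by (cases X) (auto simp: mod_Suc split: if_splits)
  show ?thesis
  proof (cases "j = Suc i mod num_vertices X")
    case True
    then show ?thesis using not_both by (simp add: e)
  next
    case False
    then show ?thesis using assms by (simp add: e rev_map comp_def)
  qed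
qed

lemma edge_image_patch:
  assumes "is_edge e"
  shows "edge_image e \<noteq> []" "\<forall>f\<in>set (edge_image e). fst f \<in> patch_faces (fst e)"
proof -
  have *: "edge_images X ! i \<noteq> [] \<and> (\<forall>f\<in>set (edge_images X ! i). fst f \<in> patch_faces X)"
    if "i < num_vertices X" for X i
  proof -
    have "\<forall>es\<in>set (edge_images X). es \<noteq> [] \<and> (\<forall>f\<in>set es. fst f \<in> patch_faces X)"
      by (cases X) auto
    moreover have "length (edge_images X) = num_vertices X"
      by (cases X) simp_all
    ultimately show ?thesis using that nth_mem by metis
  qed
  obtain X i j where e: "e = (X, i, j)" by (cases e)
  show "edge_image e \<noteq> []" "\<forall>f\<in>set (edge_image e). fst f \<in> patch_faces (fst e)"
    using assms *[of i X] *[of j X] by (auto simp: e)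
qed

lemma gluing_vector_iff:
  "gluing_vector e e' v \<longleftrightarrow>
    (e, e', v) \<in> gluing_table \<or> (reverse_edge e, reverse_edge e', v) \<in> gluing_table \<or>
    (e', e, - v) \<in> gluing_table \<or> (reverse_edge e', reverse_edge e, - v) \<in> gluing_table"
  (is "_ \<longleftrightarrow> ?R e e' v")
proof
  show "gluing_vector e e' v \<Longrightarrow> ?R e e' v"
    by (induction rule: gluing_vector.induct) auto
next
  show "gluing_vector e e' v" if "?R e e' v"
    using that gluing_vector.intros by (metis minus_minus reverse_edge_reverse_edge)
qed

lemma gluing_vector_is_edge:
  "gluing_vector e e' v \<Longrightarrow> is_edge e \<and> is_edge e'"
proof (induction rule: gluing_vector.induct)
  case (table e e' v)
  then show ?case unfolding gluing_table_def by auto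
qed auto

text \<open>No pair of edges in the table occurs again reversed or interchanged, so that closing the table
  under these operations assigns no pair of edges two vectors.\<close>

lemma gluing_table_unique:
  assumes "(e, e', v) \<in> gluing_table" "gluing_vector e e' w"
  shows "w = v"
proof -
  have "\<forall>(e, e', v)\<in>gluing_table. \<forall>w. gluing_vector e e' w \<longrightarrow> w = v"
    unfolding gluing_vector_iff gluing_table_def by simp
  then show ?thesis using assms by blast
qed

lemma gluing_vector_unique:
  "gluing_vector e e' v \<Longrightarrow> gluing_vector e e' w \<Longrightarrow> w = v"
proof (induction arbitrary: w rule: gluing_vector.induct)
  case (table e e' v)
  then show ?case by (rule gluing_table_unique)
next
  case (flip e e' v)
  show ?case
    using gluing_vector.flip[OF flip.prems] by (intro flip.IH) simp
next
  case (swap e e' v)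
  have "- w = v"
    using gluing_vector.swap[OF swap.prems] by (rule swap.IH)
  then show ?case by (metis minus_minus)
qed

text \<open>\<open>lift_offset X\<close> is the summand \<open>e\<^sub>3\<close> in the recursion for the base points below a tile of type X,
  rescaled from base points to positions.\<close>

definition lift_offset :: "prototile \<Rightarrow> int ^ 3" where
  "lift_offset X =
    (if X = C then 0 else matrix_inv Ms *v (matrix_inv Ms *v (matrix_inv Ms *v axis 3 1)))"

text \<open>If v is the difference of the positions of two tiles glued along e and e', this is
  the difference of the positions of those of their children that contain the edges f and f'.\<close>

definition refine_vector :: "edge \<Rightarrow> edge \<Rightarrow> int ^ 3 \<Rightarrow> edge \<Rightarrow> edge \<Rightarrow> int ^ 3" where
  "refine_vector e e' v f f' =
    matrix_inv Ms *v (v + u_vec (fst e') - u_vec (fst e))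
      + (lift_offset (fst e') - lift_offset (fst e)) - (u_vec (fst f') - u_vec (fst f))"

lemma refine_vector_swap: "refine_vector e' e (- v) f' f = - refine_vector e e' v f f'"
  by (simp add: refine_vector_def vec3_eq_iff)

text \<open>The arithmetic heart of the position map: the gluing table is stable under refinement.
  Reversing or interchanging the two edges commutes with taking images and with \<open>refine_vector\<close>, so that only the
  entries of the table itself have to be computed.  That the images of glued edges have equal
  length is part of the result.\<close>

lemma gluing_vector_images:
  "gluing_vector e e' v \<Longrightarrow>
    list_all2 (\<lambda>f f'. gluing_vector f f' (refine_vector e e' v f f')) (edge_image e) (edge_image e')"
proof (induction rule: gluing_vector.induct)
  case (table e e' v)
  have "\<forall>(e, e', v)\<in>gluing_table.
    list_all2 (\<lambda>f f'. gluing_vector f f' (refine_vector e e' v f f')) (edge_image e) (edge_image e')"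
    unfolding gluing_vector_iff gluing_table_def
    \<comment> \<open>Matching the edges leaves one equation between vectors for each pair of image edges.\<close>
    by simp (simp add: vec3_eq_iff refine_vector_def lift_offset_def)
  with table show ?case by blast
next
  case (flip e e' v)
  have "refine_vector (reverse_edge e) (reverse_edge e') v (reverse_edge f) (reverse_edge f') =
      refine_vector e e' v f f'" for f f'
    by (simp add: refine_vector_def)
  then have "list_all2 (\<lambda>f f'. gluing_vector (reverse_edge f) (reverse_edge f')
      (refine_vector (reverse_edge e) (reverse_edge e') v (reverse_edge f) (reverse_edge f')))
      (edge_image e) (edge_image e')"
    using flip.IH by (auto elim!: list_all2_mono intro: gluing_vector.flip)
  then show ?case
    using gluing_vector_is_edge[OF flip.hyps]
    by (simp add: edge_image_reverse list_all2_map1 list_all2_map2)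
next
  case (swap e e' v)
  have "gluing_vector f' f (refine_vector e' e (- v) f' f)"
    if "gluing_vector f f' (refine_vector e e' v f f')" for f f'
    unfolding refine_vector_swap[of e' e v f' f] using that by (rule gluing_vector.swap)
  then show ?case
    using swap.IH by (simp add: list_all2_conv_all_nth)
qed


section \<open>The position map\<close>

text \<open>The equation \<open>base_point T = Ms\<^sup>3 (position T + u_vec (tile_type T))\<close> solved for the position.\<close>

definition position :: "tile \<Rightarrow> int ^ 3" where
  "position T = matrix_inv Ms *v (matrix_inv Ms *v (matrix_inv Ms *v base_point T))
    - u_vec (tile_type T)"

lemma position_initial: "position initial_tile = 0"
  by (simp add: position_def base_point_initial vec3_eq_iff) (simp add: initial_tile_def)

lemma position_child:
  assumes "T \<in> faces p"
  shows "position (child X T) =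
    matrix_inv Ms *v (position T + u_vec (tile_type T)) + lift_offset (tile_type T) - u_vec X"
  by (simp add: position_def base_point_child[OF assms] lift_offset_def vec3_eq_iff)

text \<open>The position is a potential for the gluing vectors.  A gluing inside the patch of C has the
  vector \<open>u_vec (fst e) - u_vec (fst e')\<close>, because the children of a tile differ in position only by
  their offsets; the other gluings are refinements of earlier ones.\<close>

lemma glued_position:
  "glued p T e T' e' \<Longrightarrow>
    T \<in> faces p \<and> T' \<in> faces p \<and> tile_type T = fst e \<and> tile_type T' = fst e' \<and>
    gluing_vector e e' (position T' - position T)"
proof (induction rule: glued.induct)
  case (inner T p e e')
  have C: "tile_type T = C"
    using inner(2) by (cases "tile_type T") auto
  have "\<forall>(e, e')\<in>patch_gluing C. (e, e', u_vec (fst e) - u_vec (fst e')) \<in> gluing_table"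
    unfolding gluing_table_def by (simp add: vec3_eq_iff)
  then have "(e, e', u_vec (fst e) - u_vec (fst e')) \<in> gluing_table"
    using inner(2) unfolding C by blast
  moreover have "position (child (fst e') T) - position (child (fst e) T) =
      u_vec (fst e) - u_vec (fst e')"
    by (simp add: position_child[OF inner(1)])
  moreover have "fst e \<in> patch_faces (tile_type T)" "fst e' \<in> patch_faces (tile_type T)"
    using inner(2) unfolding C by auto
  ultimately show ?case
    using inner(1) by (auto intro: gluing_vector.table)
next
  case (outer p T e T' e' f f')
  then have T: "T \<in> faces p" "T' \<in> faces p" "tile_type T = fst e" "tile_type T' = fst e'"
    and g: "gluing_vector e e' (position T' - position T)"
    by auto
  have "gluing_vector f f' (refine_vector e e' (position T' - position T) f f')"
    using gluing_vector_images[OF g] outer.hyps(2) by (auto simp: list_all2_iff)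
  also have "refine_vector e e' (position T' - position T) f f' =
      position (child (fst f') T') - position (child (fst f) T)"
    using T by (simp add: refine_vector_def position_child vec3_eq_iff)
  finally have "gluing_vector f f' (position (child (fst f') T') - position (child (fst f) T))" .
  moreover have "fst f \<in> patch_faces (fst e)" "fst f' \<in> patch_faces (fst e')"
    using edge_image_patch(2) gluing_vector_is_edge[OF g]
      set_zip_leftD[OF outer.hyps(2)] set_zip_rightD[OF outer.hyps(2)] by blast+
  ultimately show ?case
    using T by auto
next
  case (swap p T e T' e')
  then show ?case using gluing_vector.swap[of e e' "position T' - position T"] by simp
next
  case (flip p T e T' e')
  then show ?case by (simp add: gluing_vector.flip)
qed

lemma step_position_eq:
  assumes "adjacent T T'"
  shows "step_position T T' = position T' - position T"
  unfolding step_position_def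
proof (rule the_equality)
  show "\<exists>e e'. glued_tiles T e T' e' \<and> gluing_vector e e' (position T' - position T)"
    using assms glued_position unfolding adjacent_def glued_tiles_def by blast
next
  fix v assume "\<exists>e e'. glued_tiles T e T' e' \<and> gluing_vector e e' v"
  then show "v = position T' - position T"
    using glued_position gluing_vector_unique unfolding glued_tiles_def by blast
qed

lemma tile_walk_sum:
  "tile_walk n S \<Longrightarrow> (\<Sum>i<n. step_position (S i) (S (Suc i))) = position (S n) - position (S 0)"
proof (induction n)
  case (Suc n)
  then have "tile_walk n S" "adjacent (S n) (S (Suc n))"
    by (auto simp: tile_walk_def)
  then show ?case using Suc.IH by (simp add: step_position_eq)
qed simp


section \<open>Connectedness\<close>

text \<open>In contrast to adjacent tiles, neighbours may be equal; a walk simply omits such steps.\<close>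

definition neighbours :: "nat \<Rightarrow> tile \<Rightarrow> tile \<Rightarrow> bool" where
  "neighbours p T T' \<longleftrightarrow> (\<exists>e e'. glued p T e T' e')"

lemma neighbours_sym: "neighbours p T T' \<Longrightarrow> neighbours p T' T"
  unfolding neighbours_def by (blast intro: glued.swap)

lemma patch_connected:
  assumes T: "T \<in> faces p" and XY: "X \<in> patch_faces (tile_type T)" "Y \<in> patch_faces (tile_type T)"
  shows "(neighbours (Suc p))\<^sup>*\<^sup>* (child X T) (child Y T)"
proof (cases "tile_type T = C")
  case True
  have "(e, e') \<in> patch_gluing C \<Longrightarrow> neighbours (Suc p) (child (fst e) T) (child (fst e') T)" for e e'
    unfolding neighbours_def using glued.inner[OF T] True by metis
  from this[of "(A,4,5)" "(C,5,4)"] this[of "(B,4,5)" "(C,7,6)"]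
  have n: "neighbours (Suc p) (child A T) (child C T)" "neighbours (Suc p) (child B T) (child C T)"
    by auto
  have "(neighbours (Suc p))\<^sup>*\<^sup>* (child Z T) (child C T) \<and>
      (neighbours (Suc p))\<^sup>*\<^sup>* (child C T) (child Z T)" for Z
    using n neighbours_sym by (cases Z) blast+
  then show ?thesis by (meson rtranclp_trans)
next
  case False
  then have "X = Y" using XY by (cases "tile_type T") auto
  then show ?thesis by simp
qed

text \<open>The image of an edge is never empty, so that its first edge glues two children.\<close>

lemma neighbours_children:
  assumes "neighbours p T T'"
  shows "\<exists>X\<in>patch_faces (tile_type T). \<exists>Y\<in>patch_faces (tile_type T').
    neighbours (Suc p) (child X T) (child Y T')"
proof -
  obtain e e' where g: "glued p T e T' e'"
    using assms unfolding neighbours_def by blast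
  have types: "tile_type T = fst e" "tile_type T' = fst e'"
    and v: "gluing_vector e e' (position T' - position T)"
    using glued_position[OF g] by auto
  have edges: "is_edge e" "is_edge e'"
    using gluing_vector_is_edge[OF v] by auto
  obtain f es f' es' where fs: "edge_image e = f # es" "edge_image e' = f' # es'"
    using edge_image_patch(1) edges by (meson neq_Nil_conv)
  have "neighbours (Suc p) (child (fst f) T) (child (fst f') T')"
    unfolding neighbours_def using glued.outer[OF g, of f f'] fs
    by (metis list.set_intros(1) zip_Cons_Cons)
  moreover have "fst f \<in> patch_faces (fst e)" "fst f' \<in> patch_faces (fst e')"
    using edge_image_patch(2)[OF edges(1)] edge_image_patch(2)[OF edges(2)] fs by auto
  ultimately show ?thesis using types by auto
qed

text \<open>A chain of tiles from the initial tile to S refines to a chain of children: neighbours have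
  neighbouring children, and the children of one tile are connected inside its patch.\<close>

lemma faces_connected: "T \<in> faces p \<Longrightarrow> (neighbours p)\<^sup>*\<^sup>* initial_tile T"
proof (induction p arbitrary: T)
  case 0
  then show ?case by simp
next
  case (Suc p)
  then obtain X S where T: "T = child X S" "S \<in> faces p" "X \<in> patch_faces (tile_type S)"
    by auto
  have "\<forall>X\<in>patch_faces (tile_type S). (neighbours (Suc p))\<^sup>*\<^sup>* initial_tile (child X S)"
    using Suc.IH[OF T(2)]
  proof (induction rule: rtranclp_induct)
    case base
    have "C \<in> patch_faces (tile_type initial_tile)"
      by (simp add: initial_tile_def)
    then show ?case
      using patch_connected[OF initial_tile_in_faces, of C] by (simp add: child_initial_tile)
  next
    case (step S S')
    obtain Y Z where YZ: "Y \<in> patch_faces (tile_type S)" "Z \<in> patch_faces (tile_type S')"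
      "neighbours (Suc p) (child Y S) (child Z S')"
      using neighbours_children[OF step.hyps(2)] by blast
    have S': "S' \<in> faces p"
      using step.hyps(2) glued_position unfolding neighbours_def by blast
    have "(neighbours (Suc p))\<^sup>*\<^sup>* initial_tile (child Z S')"
      using step.IH YZ by (meson rtranclp.rtrancl_into_rtrancl)
    then show ?case
      using patch_connected[OF S' YZ(2)] by (meson rtranclp_trans)
  qed
  then show ?case using T by simp
qed

lemma tile_walk_exists:
  assumes "(neighbours p)\<^sup>*\<^sup>* T T'" "T \<in> tiles"
  shows "\<exists>n S. tile_walk n S \<and> S 0 = T \<and> S n = T'"
  using assms(1)
proof (induction rule: rtranclp_induct)
  case base
  have "tile_walk 0 (\<lambda>_. T)" using assms(2) by (simp add: tile_walk_def)
  then show ?case by blast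
next
  case (step T' T'')
  then obtain n S where S: "tile_walk n S" "S 0 = T" "S n = T'"
    by blast
  obtain e e' where g: "glued p T' e T'' e'"
    using step.hyps(2) unfolding neighbours_def by blast
  show ?case
  proof (cases "T'' = T'")
    case True
    then show ?thesis using S by blast
  next
    case False
    have adj: "adjacent T' T''"
      using False g unfolding adjacent_def glued_tiles_def by blast
    have "T'' \<in> tiles"
      using glued_position[OF g] unfolding tiles_def by blast
    then have "tile_walk (Suc n) (S(Suc n := T''))"
      using S adj unfolding tile_walk_def by (auto simp: le_Suc_eq less_Suc_eq)
    then show ?thesis
      using S(2) by (metis fun_upd_other fun_upd_same nat.distinct(1))
  qed
qed

lemma omega0_eq_position:
  assumes "T \<in> tiles"
  shows "omega0 initial_tile T = position T"
proof -
  obtain p where "T \<in> faces p"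
    using assms unfolding tiles_def by blast
  moreover have "initial_tile \<in> tiles"
    using initial_tile_in_faces unfolding tiles_def by blast
  ultimately obtain n S where "tile_walk n S" "S 0 = initial_tile" "S n = T"
    using tile_walk_exists faces_connected by blast
  then show ?thesis
    unfolding omega0_def
    by (intro the_equality) (auto simp: tile_walk_sum position_initial intro!: exI)
qed


section \<open>The bijection\<close>

theorem theorem5p16:
  shows "bij_betw
    (\<lambda>T. facet (Ms ** Ms ** Ms *v (omega0 initial_tile T + u_vec (tile_type T)))
      (theta (tile_type T)))
    tiles Sigma_step"
proof -
  have "bij_betw tile_facet tiles Sigma_step"
    using inj_on_tile_facet Sigma_step_eq by (simp add: bij_betw_def)
  moreover have "tile_facet T =
      facet (Ms ** Ms ** Ms *v (omega0 initial_tile T + u_vec (tile_type T))) (theta (tile_type T))"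
    if "T \<in> tiles" for T
    unfolding omega0_eq_position[OF that]
    by (simp add: tile_facet_def position_def matrix_vector_mul_assoc[symmetric])
  ultimately show ?thesis
    using bij_betw_cong by (metis (no_types, lifting))
qed

end
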